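(* Let $x \in \mathscr{A}^{\mathbb{Z}}$ be a non-periodic Toeplitz word with separated holes, and let $\Omega$ denote the maximal equicontinuous factor of $X_x$. If there exists a factor subshift $X_{\Psi(x)} = \Psi(X_x)$ of $X_x$ with the same maximal equicontinuous factor $\Omega$ and such that the set $B_{\Psi(X)}$ is finite, then there exists $\omega \in B_X$ which has an isolated value pair with respect to $\tau_x$.
   Context: $\mathscr{A}$ is a finite alphabet; $\mathscr{A}^{\mathbb{Z}}$ carries the product topology and the left shift $\sigma(x)(j) = x(j+1)$. A word $x \in \mathscr{A}^{\mathbb{Z}}$ is a Toeplitz word if for every $j \in \mathbb{Z}$ there is $p \in \mathbb{N}$ with $x(j) = x(j+np)$ for all $n \in \mathbb{N}$ (equivalently, all $n\in\mathbb{Z}$). $X_x$ denotes the closure of $\{\sigma^n(x) : n \in \mathbb{Z}\}$ (a Toeplitz subshift). Put $\mathrm{Per}(p,x,a) = \{j \in \mathbb{Z} : x(j+np) = a \text{ for all } n \in \mathbb{Z}\}$, $\mathrm{Per}(p,x) = \bigcup_{a \in \mathscr{A}} \mathrm{Per}(p,x,a)$ and $\mathrm{Aper}(p,x) = \mathbb{Z} \setminus \mathrm{Per}(p,x)$; elements of $\mathrm{Aper}(p,x)$ are called $p$-holes. A period structure of $x$ is a sequence $(p_l)_{l \in \mathbb{N}}$ of positive integers with (i) $p_l \mid p_{l+1}$; (ii) $\emptyset \neq \mathrm{Per}(p_l,x) \neq \mathrm{Per}(p,x)$ for all $0<p<p_l$; (iii) $\bigcup_l \mathrm{Per}(p_l,x)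 = \mathbb{Z}$. Every Toeplitz word has one. $x$ has separated holes if the minimal distance between any two distinct $p_l$-holes tends to infinity as $l \to \infty$. The maximal equicontinuous factor of $X_x$ is the associated odometer $\Omega = \varprojlim \mathbb{Z}/p_l\mathbb{Z}$ with rotation $\varrho(\omega) = \omega + (1,1,1,\dots)$. For $\omega \in \Omega$, $[\omega]_l = \{\widetilde{\omega} \in \Omega : \widetilde{\omega}(i) = \omega(i) \text{ for } 1 \le i \le l\}$. Let $\eta : \mathbb{Z} \to \Omega$, $\eta(j) = (j \bmod p_1, j \bmod p_2, \dots)$. The semicocycle of $x$ is the (continuous) map $\tau_x : \eta(\mathbb{Z}) \to \mathscr{A}$, $\eta(j) \mapsto x(j)$; $F_x \subseteq \Omega \times \mathscr{A}$ is the closure of its graph, $F_x(\omega) = \{(\omega,a) \in F_x : a \in \mathscr{A}\}$, and $B_X$ is the set of all $\omega \in \Omega$ for which $F_x(\omega)$ is not a singleton. Letters $a \neq b$ in $\mathscr{A}$ are an isolated value pair for $\omega \in \Omega$ with respect to $\tau_x$ if there is $l \in \mathbb{N}$ with $\{\widetilde{\omega} \in [\omega]_l : (\widetilde{\omega},a), (\widetilde{\omega},b) \in F_x(\widetilde{\omega})\} = \{\omega\}$. A factor map between subshifts is a continuous surjective shift-commuting map; it is given by a sliding block code $\psi : \mathscr{A}^{[-J,J]} \to \mathscr{A}$ via $\Psi(x)(j) = \psi(x[j-J,j+J])$. A factor $\Psi(X_x)$ of a Toeplitz subshift is the Toeplitz subshift $X_{\Psi(x)}$. "The same maximal equicontinuous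 factor" means that the odometer associated to $\Psi(x)$ is isomorphic to $\Omega$, identified with it via $\eta$ (the image of $j$ in one odometer corresponds to the image of $j$ in the other). $B_{\Psi(X)} \subseteq \Omega$ is defined like $B_X$, using $\eta(j) \mapsto \Psi(x)(j)$. *)

theory Defs
  imports "HOL-Analysis.Analysis"
begin

section \<open>Words, shift and orbit closures\<close>

definition shift :: "(int \<Rightarrow> 'a) \<Rightarrow> int \<Rightarrow> 'a" where
  "shift x = (\<lambda>j. x (j + 1))"

definition shift_by :: "int \<Rightarrow> (int \<Rightarrow> 'a) \<Rightarrow> int \<Rightarrow> 'a" where
  "shift_by n x = (\<lambda>j. x (j + n))"

text \<open>\<open>shift_by n\<close> is the two-sided iterate of \<open>shift\<close>.\<close>

lemma funpow_shift: "(shift ^^ n) x = shift_by (int n) x"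
  by (induction n arbitrary: x) (auto simp: shift_def shift_by_def ac_simps)

lemma shift_by_inverse: "shift_by (- n) (shift_by n x) = x"
  by (simp add: shift_by_def)

definition full_shift :: "(int \<Rightarrow> 'a) topology" where
  "full_shift = product_topology (\<lambda>_. discrete_topology UNIV) UNIV"

definition orbit_closure :: "(int \<Rightarrow> 'a) \<Rightarrow> (int \<Rightarrow> 'a) set" where
  "orbit_closure x = full_shift closure_of (range (\<lambda>n. shift_by n x))"

definition factor_map ::
  "(int \<Rightarrow> 'a) set \<Rightarrow> (int \<Rightarrow> 'a) set \<Rightarrow> ((int \<Rightarrow> 'a) \<Rightarrow> int \<Rightarrow> 'a) \<Rightarrow> bool" where
  "factor_map X Y \<Psi> \<longleftrightarrow>
     continuous_map (subtopology full_shift X) (subtopology full_shift Y) \<Psi> \<and>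
     \<Psi> ` X = Y \<and>
     (\<forall>z\<in>X. \<Psi> (shift z) = shift (\<Psi> z))"

section \<open>Toeplitz words and period structures\<close>

definition toeplitz :: "(int \<Rightarrow> 'a) \<Rightarrow> bool" where
  "toeplitz x \<longleftrightarrow> (\<forall>j. \<exists>p::nat. p > 0 \<and> (\<forall>n::nat. x j = x (j + int n * int p)))"

definition periodic_word :: "(int \<Rightarrow> 'a) \<Rightarrow> bool" where
  "periodic_word x \<longleftrightarrow> (\<exists>p::nat. p > 0 \<and> (\<forall>j. x (j + int p) = x j))"

definition Per_letter :: "nat \<Rightarrow> (int \<Rightarrow> 'a) \<Rightarrow> 'a \<Rightarrow> int set" where
  "Per_letter p x a = {j. \<forall>n::int. x (j + n * int p) = a}"

definition Per :: "nat \<Rightarrow> (int \<Rightarrow> 'a) \<Rightarrow> int set" where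
  "Per p x = (\<Union>a. Per_letter p x a)"

definition Aper :: "nat \<Rightarrow> (int \<Rightarrow> 'a) \<Rightarrow> int set" where
  "Aper p x = - Per p x"

text \<open>Sequences indexed by the positive integers \<open>l = 1, 2, \<dots>\<close> in the usual notation are
  indexed here from \<open>0\<close>.\<close>

definition period_structure :: "(int \<Rightarrow> 'a) \<Rightarrow> (nat \<Rightarrow> nat) \<Rightarrow> bool" where
  "period_structure x p \<longleftrightarrow>
     (\<forall>l. p l > 0) \<and>
     (\<forall>l. p l dvd p (Suc l)) \<and>
     (\<forall>l. Per (p l) x \<noteq> {} \<and> (\<forall>q. 0 < q \<and> q < p l \<longrightarrow> Per (p l) x \<noteq> Per q x)) \<and>
     (\<Union>l. Per (p l) x) = UNIV"

definition separated_holes :: "(nat \<Rightarrow> nat) \<Rightarrow> (int \<Rightarrow> 'a) \<Rightarrow> bool" where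
  "separated_holes p x \<longleftrightarrow>
     (\<forall>M::int. \<forall>\<^sub>F l in sequentially.
        \<forall>i\<in>Aper (p l) x. \<forall>j\<in>Aper (p l) x. i \<noteq> j \<longrightarrow> M \<le> \<bar>i - j\<bar>)"

section \<open>Odometers\<close>

text \<open>The inverse limit of the groups \<open>\<int>/p\<^sub>l\<int>\<close>, residue classes being represented
  by their elements in \<open>{0..<p\<^sub>l}\<close>.\<close>

definition odometer :: "(nat \<Rightarrow> nat) \<Rightarrow> (nat \<Rightarrow> int) set" where
  "odometer p = {\<omega>. \<forall>l. \<omega> l \<in> {0..<int (p l)} \<and> \<omega> (Suc l) mod int (p l) = \<omega> l}"

definition odometer_topology :: "(nat \<Rightarrow> nat) \<Rightarrow> (nat \<Rightarrow> int) topology" where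
  "odometer_topology p =
     subtopology (product_topology (\<lambda>l. discrete_topology {0..<int (p l)}) UNIV) (odometer p)"

definition rotation :: "(nat \<Rightarrow> nat) \<Rightarrow> (nat \<Rightarrow> int) \<Rightarrow> nat \<Rightarrow> int" where
  "rotation p \<omega> = (\<lambda>l. (\<omega> l + 1) mod int (p l))"

definition eta :: "(nat \<Rightarrow> nat) \<Rightarrow> int \<Rightarrow> nat \<Rightarrow> int" where
  "eta p j = (\<lambda>l. j mod int (p l))"

definition cylinder :: "(nat \<Rightarrow> nat) \<Rightarrow> (nat \<Rightarrow> int) \<Rightarrow> nat \<Rightarrow> (nat \<Rightarrow> int) set" where
  "cylinder p \<omega> l = {\<omega>' \<in> odometer p. \<forall>i\<le>l. \<omega>' i = \<omega> i}"

text \<open>The maximal equicontinuous factor of the orbit closure of a Toeplitz word is the odometer of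
  any of its period structures. The word \<open>y\<close> has the same maximal equicontinuous factor
  \<open>odometer p\<close> if its own odometer is isomorphic to \<open>odometer p\<close> under the
  identification of the two images of each integer.\<close>

definition same_max_equicontinuous_factor :: "(nat \<Rightarrow> nat) \<Rightarrow> (int \<Rightarrow> 'a) \<Rightarrow> bool" where
  "same_max_equicontinuous_factor p y \<longleftrightarrow>
     (\<exists>q h. period_structure y q \<and>
        homeomorphic_map (odometer_topology q) (odometer_topology p) h \<and>
        (\<forall>\<omega>\<in>odometer q. h (rotation q \<omega>) = rotation p (h \<omega>)) \<and>
        (\<forall>j. h (eta q j) = eta p j))"

section \<open>Semicocycles\<close>

text \<open>The odometer \<open>odometer p\<close> and the word \<open>y\<close> are independent parameters, since the
  semicocycle of a factor is considered over the odometer of the original word. The semicocycle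
  \<open>eta p j \<mapsto> y j\<close> is represented by its graph, which is single-valued by
  \<open>semicocycle_well_defined\<close> below when \<open>p\<close> is a period structure of \<open>y\<close>.\<close>

definition semicocycle_graph :: "(nat \<Rightarrow> nat) \<Rightarrow> (int \<Rightarrow> 'a) \<Rightarrow> ((nat \<Rightarrow> int) \<times> 'a) set" where
  "semicocycle_graph p y = range (\<lambda>j. (eta p j, y j))"

lemma semicocycle_well_defined:
  assumes "period_structure y p" and "eta p i = eta p j"
  shows "y i = y j"
proof -
  from assms(1) have "i \<in> (\<Union>l. Per (p l) y)"
    by (simp add: period_structure_def)
  then obtain l a where a: "\<And>n::int. y (i + n * int (p l)) = a"
    by (auto simp: Per_def Per_letter_def)
  have "j mod int (p l) = i mod int (p l)"
    using fun_cong[OF assms(2), of l] by (simp add: eta_def)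
  then have "int (p l) dvd j - i"
    by (simp add: mod_eq_dvd_iff)
  then obtain n where "j = i + n * int (p l)"
    by (metis add_diff_cancel_left' diff_add_cancel dvdE mult.commute add.commute)
  then show ?thesis
    using a[of n] a[of 0] by simp
qed

definition F_set :: "(nat \<Rightarrow> nat) \<Rightarrow> (int \<Rightarrow> 'a) \<Rightarrow> ((nat \<Rightarrow> int) \<times> 'a) set" where
  "F_set p y = prod_topology (odometer_topology p) (discrete_topology UNIV)
                 closure_of semicocycle_graph p y"

definition F_fibre ::
  "(nat \<Rightarrow> nat) \<Rightarrow> (int \<Rightarrow> 'a) \<Rightarrow> (nat \<Rightarrow> int) \<Rightarrow> ((nat \<Rightarrow> int) \<times> 'a) set" where
  "F_fibre p y \<omega> = {(\<omega>, a) | a. (\<omega>, a) \<in> F_set p y}"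

definition B_set :: "(nat \<Rightarrow> nat) \<Rightarrow> (int \<Rightarrow> 'a) \<Rightarrow> (nat \<Rightarrow> int) set" where
  "B_set p y = {\<omega> \<in> odometer p. \<not> is_singleton (F_fibre p y \<omega>)}"

definition isolated_value_pair ::
  "(nat \<Rightarrow> nat) \<Rightarrow> (int \<Rightarrow> 'a) \<Rightarrow> (nat \<Rightarrow> int) \<Rightarrow> 'a \<Rightarrow> 'a \<Rightarrow> bool" where
  "isolated_value_pair p y \<omega> a b \<longleftrightarrow>
     a \<noteq> b \<and>
     (\<exists>l. {\<omega>' \<in> cylinder p \<omega> l. (\<omega>', a) \<in> F_set p y \<and> (\<omega>', b) \<in> F_set p y} = {\<omega>})"

end

theory Submission
  imports Defs
begin

text \<open>The factor is given by a block code with window \<open>[-J, J]\<close>. Once the holes are more than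
  \<open>2 J\<close> apart, a discontinuity of the semicocycle of \<open>\<Psi> x\<close> at \<open>\<omega>'\<close> is caused by a single
  position \<open>i\<^sub>0\<close> of the window: two letters \<open>c \<noteq> d\<close> compete at \<open>\<omega> = \<omega>' + i\<^sub>0\<close>, while the
  rest of the window is constant near \<open>\<omega>'\<close>. Whenever \<open>c\<close> and \<open>d\<close> compete at another point near
  \<open>\<omega>\<close>, translation by \<open>-i\<^sub>0\<close> gives another discontinuity of the semicocycle of \<open>\<Psi> x\<close>. As there
  are only finitely many of these, \<open>c, d\<close> is an isolated value pair for \<open>\<omega>\<close>. A discontinuity
  \<open>\<omega>'\<close> exists, for otherwise \<open>\<Psi> x\<close> would be periodic and its odometer finite.\<close>

section \<open>Cylinder descriptions of the topologies\<close>

text \<open>Common source for both spaces involved: the odometer is a subspace of such a product,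
  and the full shift is one. \<open>K\<close> collects the coordinates on which a basic open box is
  restricted; conversely, singletons on \<open>K\<close> form such a box.\<close>

lemma openin_product_discrete:
  "openin (product_topology (\<lambda>i. discrete_topology (S i)) UNIV) U \<longleftrightarrow>
     U \<subseteq> Pi\<^sub>E UNIV S \<and>
     (\<forall>z\<in>U. \<exists>K. finite K \<and> (\<forall>z'\<in>Pi\<^sub>E UNIV S. (\<forall>k\<in>K. z' k = z k) \<longrightarrow> z' \<in> U))"
    (is "?T U \<longleftrightarrow> ?R")
proof
  assume U: "?T U"
  then have "U \<subseteq> Pi\<^sub>E UNIV S"
    using openin_subset by fastforce
  moreover have "\<exists>K. finite K \<and> (\<forall>z'\<in>Pi\<^sub>E UNIV S. (\<forall>k\<in>K. z' k = z k) \<longrightarrow> z' \<in> U)"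
    if z: "z \<in> U" for z
  proof -
    obtain V where V: "finite {i. V i \<noteq> S i}" "z \<in> Pi\<^sub>E UNIV V" "Pi\<^sub>E UNIV V \<subseteq> U"
      using U z unfolding openin_product_topology_alt by auto
    have "z' \<in> U" if "z' \<in> Pi\<^sub>E UNIV S" "\<forall>k\<in>{i. V i \<noteq> S i}. z' k = z k" for z'
    proof -
      have "z' k \<in> V k" for k
        using that V(2) by (cases "V k = S k") (auto simp: PiE_iff)
      then show ?thesis
        using V(3) by (auto simp: PiE_iff)
    qed
    then show ?thesis
      using V(1) by blast
  qed
  ultimately show ?R by blast
next
  assume R: ?R
  show "?T U"
    unfolding openin_product_topology_alt
  proof
    fix z assume z: "z \<in> U"
    then obtain K where K: "finite K" "\<forall>z'\<in>Pi\<^sub>E UNIV S. (\<forall>k\<in>K. z' k = z k) \<longrightarrow> z' \<in> U"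
      using R by blast
    have zS: "z k \<in> S k" for k
      using R z by (auto simp: PiE_iff)
    let ?V = "\<lambda>k. if k \<in> K then {z k} else S k"
    have "finite {i \<in> UNIV. ?V i \<noteq> topspace (discrete_topology (S i))}"
      by (rule finite_subset[OF _ K(1)]) (auto split: if_splits)
    moreover have "\<forall>i\<in>UNIV. openin (discrete_topology (S i)) (?V i)"
      using zS by auto
    moreover have "z \<in> Pi\<^sub>E UNIV ?V"
      using zS by (auto simp: PiE_iff)
    moreover have "Pi\<^sub>E UNIV ?V \<subseteq> U"
    proof
      fix z' assume z': "z' \<in> Pi\<^sub>E UNIV ?V"
      have "z' k \<in> ?V k" for k
        using z' by (auto simp: PiE_iff)
      then have "z' k \<in> S k \<and> (k \<in> K \<longrightarrow> z' k = z k)" for k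
        using zS[of k] by (metis singletonD)
      then have "z' \<in> Pi\<^sub>E UNIV S" "\<forall>k\<in>K. z' k = z k"
        by (auto simp: PiE_iff)
      then show "z' \<in> U"
        using K(2) by blast
    qed
    ultimately show "\<exists>V. finite {i \<in> UNIV. V i \<noteq> topspace (discrete_topology (S i))} \<and>
        (\<forall>i\<in>UNIV. openin (discrete_topology (S i)) (V i)) \<and> z \<in> Pi\<^sub>E UNIV V \<and> Pi\<^sub>E UNIV V \<subseteq> U"
      by (intro exI[of _ ?V] conjI)
  qed
qed

section \<open>Residues along a divisibility chain\<close>

lemma period_dvd:
  fixes p :: "nat \<Rightarrow> nat"
  assumes "\<forall>l. p l dvd p (Suc l)" and "i \<le> l"
  shows "p i dvd p l"
  using assms(2)
proof (induction rule: dec_induct)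
  case (step n)
  then show ?case using assms(1) dvd_trans by blast
qed simp

lemma mod_period_mono:
  fixes p :: "nat \<Rightarrow> nat"
  assumes "\<forall>l. p l dvd p (Suc l)" and "i \<le> l"
  shows "j mod int (p l) mod int (p i) = j mod int (p i)"
  by (simp add: mod_mod_cancel period_dvd[OF assms])

lemma odometer_mod:
  assumes "\<omega> \<in> odometer p" and "\<forall>l. p l dvd p (Suc l)" and "i \<le> l"
  shows "\<omega> l mod int (p i) = \<omega> i"
  using assms(3)
proof (induction rule: dec_induct)
  case base
  then show ?case using assms(1) by (simp add: odometer_def)
next
  case (step n)
  have "\<omega> (Suc n) mod int (p i) = \<omega> (Suc n) mod int (p n) mod int (p i)"
    using mod_period_mono[OF assms(2)] step(1) by simp
  also have "\<omega> (Suc n) mod int (p n) = \<omega> n"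
    using assms(1) by (simp add: odometer_def)
  finally show ?case using step by simp
qed

lemma eta_in_odometer:
  assumes "\<forall>l. 0 < p l" and "\<forall>l. p l dvd p (Suc l)"
  shows "eta p j \<in> odometer p"
proof -
  have "j mod int (p (Suc l)) mod int (p l) = j mod int (p l)" for l
    by (rule mod_period_mono[OF assms(2)]) simp
  then show ?thesis
    using assms(1) unfolding odometer_def eta_def by simp
qed

lemma odometer_subset: "odometer p \<subseteq> (\<Pi>\<^sub>E l\<in>UNIV. {0..<int (p l)})"
  unfolding odometer_def PiE_iff by blast

section \<open>Cylinders as a neighbourhood base of the odometer\<close>

lemma openin_cylinder: "openin (odometer_topology p) (cylinder p \<omega> l)"
proof -
  let ?S = "\<lambda>l. {0..<int (p l)}"
  let ?V = "{z \<in> Pi\<^sub>E UNIV ?S. \<forall>i\<le>l. z i = \<omega> i}"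
  have "openin (product_topology (\<lambda>l. discrete_topology (?S l)) UNIV) ?V"
    unfolding openin_product_discrete
  proof (intro conjI ballI)
    fix z assume "z \<in> ?V"
    then show "\<exists>K. finite K \<and> (\<forall>z'\<in>Pi\<^sub>E UNIV ?S. (\<forall>k\<in>K. z' k = z k) \<longrightarrow> z' \<in> ?V)"
      by (intro exI[of _ "{..l}"]) auto
  qed auto
  moreover have "cylinder p \<omega> l = ?V \<inter> odometer p"
    using odometer_subset[of p] unfolding cylinder_def by blast
  ultimately show ?thesis
    unfolding odometer_topology_def openin_subtopology by blast
qed

lemma openin_odometer_cylinder:
  assumes "openin (odometer_topology p) U" and "\<omega> \<in> U"
  shows "\<exists>l. cylinder p \<omega> l \<subseteq> U"
proof -
  let ?S = "\<lambda>l. {0..<int (p l)}"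
  obtain V where V: "openin (product_topology (\<lambda>l. discrete_topology (?S l)) UNIV) V"
      "U = V \<inter> odometer p"
    using assms(1) unfolding odometer_topology_def openin_subtopology by blast
  then obtain K where K: "finite K"
      "\<forall>z'\<in>Pi\<^sub>E UNIV ?S. (\<forall>k\<in>K. z' k = \<omega> k) \<longrightarrow> z' \<in> V"
    using assms(2) unfolding openin_product_discrete by blast
  \<comment> \<open>Cylinders fix an initial segment of coordinates, so the finite set
    \<open>K\<close> is enlarged to all indices up to a bound.\<close>
  obtain l where l: "\<forall>k\<in>K. k \<le> l"
    using K(1) finite_nat_set_iff_bounded_le by blast
  have "cylinder p \<omega> l \<subseteq> U"
  proof
    fix z assume z: "z \<in> cylinder p \<omega> l"
    then have "z \<in> Pi\<^sub>E UNIV ?S" "\<forall>k\<in>K. z k = \<omega> k"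
      using l odometer_subset[of p] unfolding cylinder_def by blast+
    then show "z \<in> U"
      using K(2) V(2) z by (auto simp: cylinder_def)
  qed
  then show ?thesis ..
qed

section \<open>The closed graph of the semicocycle in terms of residues\<close>

lemma topspace_odometer: "topspace (odometer_topology p) = odometer p"
  unfolding odometer_topology_def by (simp add: Int_absorb1 odometer_subset)

text \<open>Letters are discrete, so the sets \<open>cylinder p \<omega> l \<times> {a}\<close> form
  a neighbourhood base at \<open>(\<omega>, a)\<close>. A cylinder is a condition on its last
  coordinate alone, since a residue modulo \<open>p l\<close> determines those modulo all earlier
  periods. From here on, topology is replaced by arithmetic of residues.\<close>

lemma F_set_iff:
  assumes pos: "\<forall>l. 0 < p l" and dvd: "\<forall>l. p l dvd p (Suc l)"
  shows "(\<omega>, a) \<in> F_set p y \<longleftrightarrow>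
    \<omega> \<in> odometer p \<and> (\<forall>l. \<exists>j. j mod int (p l) = \<omega> l \<and> y j = a)"
proof
  assume F: "(\<omega>, a) \<in> F_set p y"
  then have \<omega>: "\<omega> \<in> odometer p"
    by (auto simp: F_set_def in_closure_of topspace_odometer)
  have "\<exists>j. j mod int (p l) = \<omega> l \<and> y j = a" for l
  proof -
    have "openin (prod_topology (odometer_topology p) (discrete_topology UNIV))
        (cylinder p \<omega> l \<times> {a})"
      by (simp add: openin_prod_Times_iff openin_cylinder)
    moreover have "(\<omega>, a) \<in> cylinder p \<omega> l \<times> {a}"
      using \<omega> by (simp add: cylinder_def)
    ultimately have "\<exists>z. z \<in> semicocycle_graph p y \<and> z \<in> cylinder p \<omega> l \<times> {a}"
      using conjunct2[OF F[unfolded F_set_def in_closure_of]] by (elim allE impE) (rule conjI)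
    then show ?thesis
      by (auto simp: semicocycle_graph_def cylinder_def eta_def)
  qed
  then show "\<omega> \<in> odometer p \<and> (\<forall>l. \<exists>j. j mod int (p l) = \<omega> l \<and> y j = a)"
    using \<omega> by blast
next
  assume R: "\<omega> \<in> odometer p \<and> (\<forall>l. \<exists>j. j mod int (p l) = \<omega> l \<and> y j = a)"
  show "(\<omega>, a) \<in> F_set p y"
    unfolding F_set_def in_closure_of
  proof (intro conjI allI impI)
    show "(\<omega>, a) \<in> topspace (prod_topology (odometer_topology p) (discrete_topology UNIV))"
      using R by (simp add: topspace_odometer)
    fix T
    assume "(\<omega>, a) \<in> T \<and> openin (prod_topology (odometer_topology p) (discrete_topology UNIV)) T"
    then obtain U V where UV: "openin (odometer_topology p) U" "\<omega> \<in> U" "a \<in> V" "U \<times> V \<subseteq> T"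
      unfolding openin_prod_topology_alt by blast
    then obtain l where l: "cylinder p \<omega> l \<subseteq> U"
      using openin_odometer_cylinder by blast
    obtain j where j: "j mod int (p l) = \<omega> l" "y j = a"
      using R by blast
    have "eta p j i = \<omega> i" if "i \<le> l" for i
      using odometer_mod[OF _ dvd that] mod_period_mono[OF dvd that, of j] R j(1)
      by (simp add: eta_def)
    then have "eta p j \<in> cylinder p \<omega> l"
      using eta_in_odometer[OF pos dvd] by (simp add: cylinder_def)
    then have "(eta p j, y j) \<in> T"
      using l UV j by blast
    then show "\<exists>z. z \<in> semicocycle_graph p y \<and> z \<in> T"
      by (auto simp: semicocycle_graph_def)
  qed
qed

text \<open>A compactness principle for finite types: if every \<open>b\<close> failed at some level
  \<open>f b\<close>, all of them would fail together at the largest of these levels.\<close>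

lemma decreasing_pigeonhole:
  fixes P :: "nat \<Rightarrow> 'b::finite \<Rightarrow> bool"
  assumes "\<And>l. \<exists>b. P l b" and anti: "\<And>k l b. k \<le> l \<Longrightarrow> P l b \<Longrightarrow> P k b"
  shows "\<exists>b. \<forall>l. P l b"
proof (rule ccontr)
  assume "\<not> ?thesis"
  then obtain f where f: "\<And>b. \<not> P (f b) b"
    by metis
  obtain b where "P (Max (range f)) b"
    using assms(1) by blast
  then have "P (f b) b"
    by (rule anti[rotated]) simp
  then show False
    using f by blast
qed

text \<open>A fibre that is not a singleton could also be empty. Finiteness of the alphabet excludes
  this: every residue class carries some letter, and one letter must occur at all levels.\<close>

lemma B_set_iff:
  fixes y :: "int \<Rightarrow> 'a::finite"
  assumes pos: "\<forall>l. 0 < p l" and dvd: "\<forall>l. p l dvd p (Suc l)"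
  shows "\<omega> \<in> B_set p y \<longleftrightarrow> (\<exists>a b. a \<noteq> b \<and> (\<omega>, a) \<in> F_set p y \<and> (\<omega>, b) \<in> F_set p y)"
proof
  assume B: "\<omega> \<in> B_set p y"
  then have \<omega>: "\<omega> \<in> odometer p"
    by (simp add: B_set_def)
  have "\<exists>a. \<forall>l. \<exists>j. j mod int (p l) = \<omega> l \<and> y j = a"
  proof (rule decreasing_pigeonhole)
    show "\<exists>a j. j mod int (p l) = \<omega> l \<and> y j = a" for l
      using odometer_mod[OF \<omega> dvd order_refl] by blast
    show "\<exists>j. j mod int (p k) = \<omega> k \<and> y j = a"
      if "k \<le> l" "\<exists>j. j mod int (p l) = \<omega> l \<and> y j = a" for k l a
      using that odometer_mod[OF \<omega> dvd that(1)] mod_period_mono[OF dvd that(1)] by metis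
  qed
  then obtain a where a: "(\<omega>, a) \<in> F_set p y"
    unfolding F_set_iff[OF pos dvd] using \<omega> by blast
  show "\<exists>a b. a \<noteq> b \<and> (\<omega>, a) \<in> F_set p y \<and> (\<omega>, b) \<in> F_set p y"
  proof (rule ccontr)
    assume "\<not> ?thesis"
    then have "F_fibre p y \<omega> = {(\<omega>, a)}"
      using a by (auto simp: F_fibre_def)
    then show False
      using B by (simp add: B_set_def)
  qed
next
  assume "\<exists>a b. a \<noteq> b \<and> (\<omega>, a) \<in> F_set p y \<and> (\<omega>, b) \<in> F_set p y"
  then obtain a b where ab: "a \<noteq> b" "(\<omega>, a) \<in> F_set p y" "(\<omega>, b) \<in> F_set p y"
    by blast
  then have "(\<omega>, a) \<in> F_fibre p y \<omega>" "(\<omega>, b) \<in> F_fibre p y \<omega>"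
    by (auto simp: F_fibre_def)
  then have "\<not> is_singleton (F_fibre p y \<omega>)"
    using ab(1) by (metis is_singletonE singletonD prod.inject)
  moreover have "\<omega> \<in> odometer p"
    using ab(2) unfolding F_set_iff[OF pos dvd] by blast
  ultimately show "\<omega> \<in> B_set p y"
    by (simp add: B_set_def)
qed

section \<open>Existence of discontinuities\<close>

text \<open>If no \<open>p l\<close> is a period, each level has a position \<open>f l\<close> where
  periodicity fails. The points \<open>eta p (f l)\<close> accumulate in the compact odometer, and
  at an accumulation point the letters at \<open>f k\<close> and \<open>f k + p k\<close>
  compete.\<close>

lemma periodic_if_B_set_empty:
  fixes y :: "int \<Rightarrow> 'a::finite"
  assumes pos: "\<forall>l. 0 < p l" and dvd: "\<forall>l. p l dvd p (Suc l)"
    and B: "B_set p y = {}"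
  shows "periodic_word y"
proof (rule ccontr)
  assume np: "\<not> periodic_word y"
  have "\<exists>j. y (j + int (p l)) \<noteq> y j" for l
    using np pos unfolding periodic_word_def by blast
  then obtain f where f: "\<And>l. y (f l + int (p l)) \<noteq> y (f l)"
    by metis
  let ?inf = "\<lambda>l r. infinite {k. f k mod int (p l) = r}"
  \<comment> \<open>The accumulation point is built level by level, keeping a residue class visited
    by \<open>f k\<close> for infinitely many \<open>k\<close>.\<close>
  have "\<exists>\<omega>. \<forall>l. (\<omega> l \<in> {0..<int (p l)} \<and> ?inf l (\<omega> l)) \<and> \<omega> (Suc l) mod int (p l) = \<omega> l"
  proof (rule dependent_nat_choice)
    have "\<exists>r\<in>{0..<int (p 0)}. infinite {k \<in> UNIV. f k mod int (p 0) = r}"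
      using pos by (intro pigeonhole_infinite_rel) auto
    then show "\<exists>r. r \<in> {0..<int (p 0)} \<and> ?inf 0 r"
      by auto
  next
    fix r l assume r: "r \<in> {0..<int (p l)} \<and> ?inf l r"
    have "\<exists>s\<in>{0..<int (p (Suc l))}.
        infinite {k \<in> {k. f k mod int (p l) = r}. f k mod int (p (Suc l)) = s}"
      using pos r by (intro pigeonhole_infinite_rel) auto
    then obtain s where s: "s \<in> {0..<int (p (Suc l))}"
        "infinite {k. f k mod int (p l) = r \<and> f k mod int (p (Suc l)) = s}"
      by auto
    \<comment> \<open>One common element of the two classes already shows that \<open>s\<close>
      refines \<open>r\<close>.\<close>
    then obtain k where "f k mod int (p l) = r" "f k mod int (p (Suc l)) = s"
      using not_finite_existsD by blast
    then have "s mod int (p l) = r"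
      using mod_period_mono[OF dvd, of l "Suc l" "f k"] by simp
    moreover have "?inf (Suc l) s"
      using s(2) by (rule contrapos_nn) (auto elim: rev_finite_subset)
    ultimately show "\<exists>s. (s \<in> {0..<int (p (Suc l))} \<and> ?inf (Suc l) s) \<and> s mod int (p l) = r"
      using s(1) by blast
  qed
  then obtain \<omega> where \<omega>: "\<omega> \<in> odometer p" "\<And>l. ?inf l (\<omega> l)"
    by (auto simp: odometer_def)
  let ?P = "\<lambda>l (a, b). a \<noteq> b \<and> (\<exists>j. j mod int (p l) = \<omega> l \<and> y j = a)
      \<and> (\<exists>j. j mod int (p l) = \<omega> l \<and> y j = b)"
  have "\<exists>ab. \<forall>l. ?P l ab"
  proof (rule decreasing_pigeonhole)
    fix l
    \<comment> \<open>With \<open>k \<ge> l\<close>, \<open>p l\<close> divides \<open>p k\<close>,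
      so both positions of the failing pair lie in the class \<open>\<omega> l\<close>.\<close>
    obtain k where k: "k \<ge> l" "f k mod int (p l) = \<omega> l"
      using \<omega>(2)[of l] unfolding infinite_nat_iff_unbounded_le by blast
    moreover have "(f k + int (p k)) mod int (p l) = f k mod int (p l)"
      using period_dvd[OF dvd k(1)] by (metis mod_add_right_eq dvd_imp_mod_0 int_dvd_int_iff add.right_neutral)
    ultimately have "?P l (y (f k), y (f k + int (p k)))"
      using f[of k] by auto
    then show "\<exists>ab. ?P l ab" by blast
  next
    fix k l ab assume "k \<le> (l::nat)" "?P l ab"
    then show "?P k ab"
      using odometer_mod[OF \<omega>(1) dvd, of k l] mod_period_mono[OF dvd, of k l]
      by (auto split: prod.splits) metis+
  qed
  then obtain a b where "a \<noteq> b" "(\<omega>, a) \<in> F_set p y" "(\<omega>, b) \<in> F_set p y"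
    unfolding F_set_iff[OF pos dvd] using \<omega>(1) by (auto split: prod.splits)
  then have "\<omega> \<in> B_set p y"
    unfolding B_set_iff[OF pos dvd] by blast
  then show False
    using B by blast
qed

text \<open>Modulo a period \<open>P\<close> of \<open>y\<close> there are only finitely many
  positions, so some \<open>Per (q L) y\<close> contains all of them and hence every integer. Later
  sets \<open>Per (q l) y\<close> cannot grow, and minimality of \<open>q l\<close> rules out
  \<open>q L < q l\<close>.\<close>

lemma period_structure_eventually_constant:
  assumes ps: "period_structure y q" and "periodic_word y"
  shows "\<exists>L. \<forall>l\<ge>L. q l = q L"
proof -
  have pos: "\<And>l. 0 < q l" and dvd: "\<forall>l. q l dvd q (Suc l)"
    and minimal: "\<And>l r. 0 < r \<Longrightarrow> r < q l \<Longrightarrow> Per (q l) y \<noteq> Per r y"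
    and cover: "(\<Union>l. Per (q l) y) = UNIV"
    using ps by (auto simp: period_structure_def)
  have mono: "Per (q k) y \<subseteq> Per (q l) y" if kl: "k \<le> l" for k l
  proof -
    obtain m where "q l = q k * m"
      using period_dvd[OF dvd kl] by blast
    then have "n * int (q l) = (n * int m) * int (q k)" for n
      by simp
    then show ?thesis
      unfolding Per_def Per_letter_def by (auto, metis)
  qed
  obtain P where P: "P > 0" "\<And>j. y (j + int P) = y j"
    using assms(2) unfolding periodic_word_def by blast
  have nper: "y (j + int n * int P) = y j" for j n
  proof (induction n)
    case (Suc n)
    have "j + int (Suc n) * int P = (j + int n * int P) + int P"
      by (simp add: algebra_simps)
    then show ?case using Suc P(2) by metis
  qed simp
  have per: "y (j + n * int P) = y j" for j n
  proof (cases "0 \<le> n")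
    case True
    then show ?thesis using nper[of j "nat n"] by simp
  next
    case False
    then show ?thesis using nper[of "j + n * int P" "nat (- n)"] by simp
  qed
  have "\<forall>j. \<exists>l. j \<in> Per (q l) y"
    using cover by blast
  then obtain g where g: "\<And>j. j \<in> Per (q (g j)) y"
    by (auto dest!: choice)
  define L where "L = Max (g ` {0..<int P})"
  have "j \<in> Per (q L) y" for j
  proof -
    have "j mod int P \<in> {0..<int P}"
      using P(1) by simp
    then have "g (j mod int P) \<le> L"
      unfolding L_def by (intro Max_ge) auto
    then have "j mod int P \<in> Per (q L) y"
      using g mono by blast
    \<comment> \<open>Reducing \<open>j\<close> modulo \<open>P\<close> changes the argument by a
      multiple of \<open>P\<close>, so the progression through \<open>j\<close> reads the same
      letters.\<close>
    moreover have "y (j + n * int (q L)) = y (j mod int P + n * int (q L))" for n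
    proof -
      have "j + n * int (q L) = (j mod int P + n * int (q L)) + j div int P * int P"
        using div_mult_mod_eq[of j "int P"] by linarith
      then show ?thesis
        by (metis per)
    qed
    ultimately show ?thesis
      by (auto simp: Per_def Per_letter_def)
  qed
  then have "Per (q L) y = UNIV" by blast
  then have Per_eq: "Per (q l) y = Per (q L) y" if "l \<ge> L" for l
    using mono[OF that] by blast
  have "q l = q L" if l: "l \<ge> L" for l
  proof -
    have "q L \<le> q l"
      using period_dvd[OF dvd l] pos by (rule dvd_imp_le)
    moreover have "\<not> q L < q l"
      using minimal[OF pos, of L l] Per_eq[OF l] by blast
    ultimately show ?thesis by simp
  qed
  then show ?thesis by blast
qed

text \<open>The odometer of a periodic \<open>y\<close> is finite, so \<open>eta q\<close> has
  period \<open>q L\<close>. The identification \<open>h\<close> carries this period over to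
  \<open>eta p\<close>, and \<open>x j\<close> depends only on \<open>eta p j\<close>.\<close>

lemma periodic_if_factor_periodic:
  assumes ps: "period_structure x p" and "periodic_word y"
    and "same_max_equicontinuous_factor p y"
  shows "periodic_word x"
proof -
  obtain q h where q: "period_structure y q" and h: "\<And>j. h (eta q j) = eta p j"
    using assms(3) unfolding same_max_equicontinuous_factor_def by blast
  obtain L where L: "\<And>l. l \<ge> L \<Longrightarrow> q l = q L"
    using period_structure_eventually_constant[OF q assms(2)] by blast
  have dvd: "\<forall>l. q l dvd q (Suc l)" and pos: "0 < q L"
    using q by (auto simp: period_structure_def)
  have "q l dvd q L" for l
    using period_dvd[OF dvd, of l L] L[of l] by (cases "l \<le> L") auto
  then have "eta q (j + int (q L)) = eta q j" for j
    unfolding eta_def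
    by (intro ext) (metis mod_add_right_eq dvd_imp_mod_0 int_dvd_int_iff add.right_neutral)
  then have "eta p (j + int (q L)) = eta p j" for j
    using h by metis
  then have "x (j + int (q L)) = x j" for j
    using semicocycle_well_defined[OF ps] by blast
  then show ?thesis
    using pos unfolding periodic_word_def by blast
qed

section \<open>Factor maps are block codes\<close>

lemma shift_by_in_orbit_closure: "shift_by n x \<in> orbit_closure x"
proof -
  have "range (\<lambda>n. shift_by n x) \<subseteq> orbit_closure x"
    unfolding orbit_closure_def by (rule closure_of_subset) (simp add: full_shift_def)
  then show ?thesis by blast
qed

lemma factor_map_shift_by:
  assumes "factor_map (orbit_closure x) Y \<Psi>"
  shows "\<Psi> (shift_by n x) = shift_by n (\<Psi> x)"
proof (induction n rule: int_induct[where k = 0])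
  case base
  then show ?case by (simp add: shift_by_def)
next
  case (step1 n)
  have "\<Psi> (shift (shift_by n x)) = shift (\<Psi> (shift_by n x))"
    using assms shift_by_in_orbit_closure unfolding factor_map_def by blast
  moreover have "shift (shift_by n z) = shift_by (n + 1) z" for z :: "int \<Rightarrow> 'c"
    by (simp add: shift_def shift_by_def algebra_simps)
  ultimately show ?case using step1
    by (metis shift_def shift_by_def add.assoc add.commute)
next
  case (step2 n)
  \<comment> \<open>Going down, the commutation rule is applied at
    \<open>shift_by (n - 1) x\<close>, and one shift is then cancelled by evaluating at
    \<open>j - 1\<close>.\<close>
  have "\<Psi> (shift (shift_by (n - 1) x)) = shift (\<Psi> (shift_by (n - 1) x))"
    using assms shift_by_in_orbit_closure unfolding factor_map_def by blast
  moreover have "shift (shift_by (n - 1) x) = shift_by n x"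
    by (simp add: shift_def shift_by_def algebra_simps)
  ultimately have *: "shift (\<Psi> (shift_by (n - 1) x)) = shift_by n (\<Psi> x)"
    using step2 by simp
  show ?case
  proof
    fix j
    show "\<Psi> (shift_by (n - 1) x) j = shift_by (n - 1) (\<Psi> x) j"
      using fun_cong[OF *, of "j - 1"] by (simp add: shift_def shift_by_def algebra_simps)
  qed
qed

lemma openin_full_shift:
  fixes U :: "(int \<Rightarrow> 'a) set"
  shows "openin full_shift U \<longleftrightarrow> (\<forall>z\<in>U. \<exists>K. finite K \<and> (\<forall>z'. (\<forall>k\<in>K. z' k = z k) \<longrightarrow> z' \<in> U))"
proof -
  have *: "Pi\<^sub>E UNIV (\<lambda>_. UNIV) = (UNIV :: (int \<Rightarrow> 'a) set)"
    by (simp add: PiE_UNIV_domain)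
  show ?thesis
    by (simp only: full_shift_def openin_product_discrete * subset_UNIV simp_thms ball_UNIV)
qed

lemma compactin_orbit_closure:
  fixes x :: "int \<Rightarrow> 'a::finite"
  shows "compactin full_shift (orbit_closure x)"
proof -
  have "compact_space (full_shift :: (int \<Rightarrow> 'a) topology)"
    by (simp add: full_shift_def compact_space_product_topology compact_space_discrete_topology)
  then show ?thesis
    unfolding orbit_closure_def by (simp add: closedin_compact_space)
qed

text \<open>The Curtis-Hedlund-Lyndon argument, stated along the orbit of \<open>x\<close>.
  Continuity gives each point of the orbit closure its own window deciding coordinate 0 of the
  image; compactness leaves finitely many windows, and \<open>J\<close> is the largest.\<close>

lemma factor_map_block_code:
  fixes x :: "int \<Rightarrow> 'a::finite"
  assumes "factor_map (orbit_closure x) Y \<Psi>"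
  shows "\<exists>J. \<forall>m n. (\<forall>i. \<bar>i\<bar> \<le> J \<longrightarrow> x (m + i) = x (n + i)) \<longrightarrow> \<Psi> x m = \<Psi> x n"
proof -
  let ?X = "orbit_closure x"
  have cont: "continuous_map (subtopology full_shift ?X) full_shift \<Psi>"
    using assms unfolding factor_map_def continuous_map_in_subtopology by blast
  define N where "N = (\<lambda>z J. {z' :: int \<Rightarrow> 'a. \<forall>k. \<bar>k\<bar> \<le> J \<longrightarrow> z' k = z k})"
  have N_open: "openin full_shift (N z J)" for z J
    unfolding openin_full_shift
  proof
    fix z' assume z': "z' \<in> N z J"
    show "\<exists>K. finite K \<and> (\<forall>z''. (\<forall>k\<in>K. z'' k = z' k) \<longrightarrow> z'' \<in> N z J)"
      using z' by (intro exI[of _ "{-J..J}"]) (auto simp: N_def abs_le_iff)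
  qed
  have "\<exists>J. \<forall>z'\<in>?X \<inter> N z J. \<Psi> z' 0 = \<Psi> z 0" if z: "z \<in> ?X" for z
  proof -
    have "openin full_shift {w. w 0 = \<Psi> z 0}"
      unfolding openin_full_shift by (auto intro!: exI[of _ "{0}"])
    then have "openin (subtopology full_shift ?X)
        {z' \<in> topspace (subtopology full_shift ?X). \<Psi> z' \<in> {w. w 0 = \<Psi> z 0}}"
      using cont openin_continuous_map_preimage by blast
    then obtain U where U: "openin full_shift U" "{z' \<in> ?X. \<Psi> z' 0 = \<Psi> z 0} = U \<inter> ?X"
      unfolding openin_subtopology by (auto simp: full_shift_def)
    then obtain K where K: "finite K" "\<forall>z'. (\<forall>k\<in>K. z' k = z k) \<longrightarrow> z' \<in> U"
      using z unfolding openin_full_shift by blast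
    \<comment> \<open>If \<open>K\<close> is empty the maximum is unspecified, but then
      \<open>U\<close> contains every word and any window serves.\<close>
    have "\<bar>k\<bar> \<le> Max (abs ` K)" if "k \<in> K" for k
      using K(1) that by simp
    then have "N z (Max (abs ` K)) \<subseteq> U"
      using K(2) by (auto simp: N_def)
    then show ?thesis
      using U(2) by blast
  qed
  then obtain W where W: "\<And>z z'. z \<in> ?X \<Longrightarrow> z' \<in> ?X \<Longrightarrow> z' \<in> N z (W z) \<Longrightarrow> \<Psi> z' 0 = \<Psi> z 0"
    by (metis IntI)
  have "?X \<subseteq> (\<Union>z\<in>?X. N z (W z))"
    by (auto simp: N_def)
  then obtain \<F> where \<F>: "finite \<F>" "\<F> \<subseteq> (\<lambda>z. N z (W z)) ` ?X" "?X \<subseteq> \<Union>\<F>"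
    using compactinD[OF compactin_orbit_closure[of x], of "(\<lambda>z. N z (W z)) ` ?X"] N_open
    by blast
  then obtain Z where Z: "finite Z" "Z \<subseteq> ?X" "?X \<subseteq> (\<Union>z\<in>Z. N z (W z))"
    using finite_subset_image[OF \<F>(1,2)] by blast
  have "\<Psi> x m = \<Psi> x n"
    if agree: "\<forall>i. \<bar>i\<bar> \<le> Max (W ` Z) \<longrightarrow> x (m + i) = x (n + i)" for m n
  proof -
    \<comment> \<open>Agreement on the largest window places both shifts of \<open>x\<close> in the
      same neighbourhood \<open>N z (W z)\<close>.\<close>
    obtain z where z: "z \<in> Z" "shift_by m x \<in> N z (W z)"
      using Z(3) shift_by_in_orbit_closure by blast
    have "W z \<le> Max (W ` Z)"
      using Z(1) z(1) by simp
    then have "shift_by n x \<in> N z (W z)"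
      using z(2) agree by (auto simp: N_def shift_by_def add.commute)
    then have "\<Psi> (shift_by m x) 0 = \<Psi> (shift_by n x) 0"
      using W z Z(2) shift_by_in_orbit_closure by (metis subsetD)
    then show ?thesis
      by (simp add: factor_map_shift_by[OF assms]) (simp add: shift_by_def)
  qed
  then show ?thesis by blast
qed

section \<open>Isolated value pairs\<close>

text \<open>The action of the integer \<open>i\<close> on the odometer: \<open>translate p 1\<close>
  is \<open>rotation p\<close>, and \<open>eta p j\<close> is sent to
  \<open>eta p (j + i)\<close>.\<close>

definition translate :: "(nat \<Rightarrow> nat) \<Rightarrow> int \<Rightarrow> (nat \<Rightarrow> int) \<Rightarrow> nat \<Rightarrow> int" where
  "translate p i \<omega> = (\<lambda>l. (\<omega> l + i) mod int (p l))"

lemma translate_in_odometer: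
  assumes "\<forall>l. 0 < p l" and "\<forall>l. p l dvd p (Suc l)" and "\<omega> \<in> odometer p"
  shows "translate p i \<omega> \<in> odometer p"
proof -
  have "(\<omega> (Suc l) + i) mod int (p (Suc l)) mod int (p l) = (\<omega> l + i) mod int (p l)" for l
  proof -
    have "(\<omega> (Suc l) + i) mod int (p (Suc l)) mod int (p l) = (\<omega> (Suc l) + i) mod int (p l)"
      using mod_period_mono[OF assms(2), of l "Suc l"] by simp
    also have "\<dots> = (\<omega> (Suc l) mod int (p l) + i) mod int (p l)"
      by (simp add: mod_simps)
    finally show ?thesis
      using assms(3) by (simp add: odometer_def)
  qed
  then show ?thesis
    using assms(1) by (auto simp: odometer_def translate_def)
qed

lemma translate_translate:
  assumes "\<omega> \<in> odometer p"
  shows "translate p (- i) (translate p i \<omega>) = \<omega>"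
  using assms by (auto simp: translate_def odometer_def mod_simps)

lemma Per_mod_cong:
  assumes "i \<in> Per p x" and "j mod int p = i mod int p"
  shows "x j = x i"
proof -
  obtain a where a: "\<And>n. x (i + n * int p) = a"
    using assms(1) by (auto simp: Per_def Per_letter_def)
  obtain n where "j = i + n * int p"
    using assms(2) by (metis mod_eq_dvd_iff dvdE mult.commute add.commute diff_add_cancel)
  then show ?thesis
    using a[of n] a[of 0] by simp
qed

theorem corollary5p5:
  fixes x :: "int \<Rightarrow> 'a::finite" and p :: "nat \<Rightarrow> nat"
  assumes "toeplitz x"
    and "\<not> periodic_word x"
    and "period_structure x p"
    and "separated_holes p x"
    and "\<exists>\<Psi>. factor_map (orbit_closure x) (orbit_closure (\<Psi> x)) \<Psi> \<and>
             same_max_equicontinuous_factor p (\<Psi> x) \<and>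
             finite (B_set p (\<Psi> x))"
  shows "\<exists>\<omega>\<in>B_set p x. \<exists>a b. isolated_value_pair p x \<omega> a b"
proof -
  have pos: "\<forall>l. 0 < p l" and dvd: "\<forall>l. p l dvd p (Suc l)"
    using assms(3) by (auto simp: period_structure_def)
  note F_iff = F_set_iff[OF pos dvd] and B_iff = B_set_iff[OF pos dvd]
  obtain \<Psi> where \<Psi>: "factor_map (orbit_closure x) (orbit_closure (\<Psi> x)) \<Psi>"
      "same_max_equicontinuous_factor p (\<Psi> x)" "finite (B_set p (\<Psi> x))"
    using assms(5) by blast
  define y where "y = \<Psi> x"
  obtain J where J: "\<And>m n. (\<And>i. \<bar>i\<bar> \<le> J \<Longrightarrow> x (m + i) = x (n + i)) \<Longrightarrow> y m = y n"
    using factor_map_block_code[OF \<Psi>(1)] unfolding y_def by blast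
  have "B_set p y \<noteq> {}"
    using periodic_if_B_set_empty[OF pos dvd, of y] assms(2) \<Psi>(2)
      periodic_if_factor_periodic[OF assms(3), of y] unfolding y_def by blast
  then obtain \<omega>' where "\<omega>' \<in> B_set p y"
    by blast
  then obtain a b where ab: "a \<noteq> b" "(\<omega>', a) \<in> F_set p y" "(\<omega>', b) \<in> F_set p y"
    unfolding B_iff by blast
  then have \<omega>': "\<omega>' \<in> odometer p"
    unfolding F_iff by blast
  \<comment> \<open>Two positions of a window \<open>[-J, J]\<close> differ by at most
    \<open>2 * J\<close>, so at level \<open>L\<close> each window contains at most one
    hole.\<close>
  obtain L where L: "\<And>i j. i \<in> Aper (p L) x \<Longrightarrow> j \<in> Aper (p L) x \<Longrightarrow> i \<noteq> j
      \<Longrightarrow> 2 * J + 1 \<le> \<bar>i - j\<bar>"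
    using assms(4) unfolding separated_holes_def eventually_sequentially by blast
  \<comment> \<open>Being a hole depends only on the residue, so \<open>\<omega>' L + i\<close> can
    stand for the class of \<open>m + i\<close> and \<open>n + i\<close>.\<close>
  have hole: "\<omega>' L + i \<in> Aper (p L) x"
    if "m mod int (p L) = \<omega>' L" "n mod int (p L) = \<omega>' L" "x (m + i) \<noteq> x (n + i)" for m n i
  proof (rule ccontr)
    assume "\<omega>' L + i \<notin> Aper (p L) x"
    then have *: "\<omega>' L + i \<in> Per (p L) x"
      by (simp add: Aper_def)
    have "(m + i) mod int (p L) = (\<omega>' L + i) mod int (p L)"
      "(n + i) mod int (p L) = (\<omega>' L + i) mod int (p L)"
      using that(1,2) by (metis mod_add_left_eq)+
    then show False
      using Per_mod_cong[OF *] that(3) by metis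
  qed
  have differ: "\<exists>m n i. m mod int (p l) = \<omega>' l \<and> n mod int (p l) = \<omega>' l
      \<and> y m = a \<and> y n = b \<and> \<bar>i\<bar> \<le> J \<and> x (m + i) \<noteq> x (n + i)" for l
  proof -
    obtain m n where "m mod int (p l) = \<omega>' l" "n mod int (p l) = \<omega>' l" "y m = a" "y n = b"
      using ab(2,3) unfolding F_iff by blast
    moreover have "\<exists>i. \<bar>i\<bar> \<le> J \<and> x (m + i) \<noteq> x (n + i)"
      using J[of m n] calculation(3,4) ab(1) by blast
    ultimately show ?thesis by blast
  qed
  obtain i0 where i0: "\<omega>' L + i0 \<in> Aper (p L) x" "\<bar>i0\<bar> \<le> J"
    using differ[of L] hole by blast
  have unique: "i = i0" if "\<omega>' L + i \<in> Aper (p L) x" "\<bar>i\<bar> \<le> J" for i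
    using L[OF that(1) i0(1)] that(2) i0(2) by fastforce
  \<comment> \<open>Levels start at \<open>L\<close>, so that every sample pair differs at the one
    position \<open>i0\<close>. Only the competing letters may still vary with the level, and the
    pigeonhole principle fixes them.\<close>
  let ?P = "\<lambda>l (c, d). \<exists>m n. m mod int (p (L + l)) = \<omega>' (L + l) \<and> n mod int (p (L + l)) = \<omega>' (L + l)
      \<and> y m = a \<and> y n = b \<and> x (m + i0) = c \<and> x (n + i0) = d \<and> c \<noteq> d"
  have down: "m mod int (p k) = \<omega>' k" if "k \<le> l" "m mod int (p l) = \<omega>' l" for k l m
    using that odometer_mod[OF \<omega>' dvd] mod_period_mono[OF dvd] by metis
  have "\<exists>cd. \<forall>l. ?P l cd"
  proof (rule decreasing_pigeonhole)
    fix l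
    obtain m n i where mni: "m mod int (p (L + l)) = \<omega>' (L + l)" "n mod int (p (L + l)) = \<omega>' (L + l)"
        "y m = a" "y n = b" "\<bar>i\<bar> \<le> J" "x (m + i) \<noteq> x (n + i)"
      using differ by blast
    then have "i = i0"
      using hole[of m n i] unique down[of L "L + l"] by simp
    then have "?P l (x (m + i0), x (n + i0))"
      using mni by auto
    then show "\<exists>cd. ?P l cd" ..
  next
    fix k l cd assume "k \<le> (l::nat)" "?P l cd"
    then show "?P k cd"
      using down[of "L + k" "L + l"] by (clarsimp split: prod.splits) metis
  qed
  then obtain c d where cd: "\<And>l. ?P l (c, d)"
    by auto
  define \<omega> where "\<omega> = translate p i0 \<omega>'"
  have \<omega>: "\<omega> \<in> odometer p"
    unfolding \<omega>_def by (rule translate_in_odometer[OF pos dvd \<omega>'])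
  have cd_neq: "c \<noteq> d"
    using cd[of 0] by auto
  have F\<omega>: "(\<omega>, c) \<in> F_set p x" "(\<omega>, d) \<in> F_set p x"
  proof -
    have "\<exists>m n. (m + i0) mod int (p l) = \<omega> l \<and> (n + i0) mod int (p l) = \<omega> l
        \<and> x (m + i0) = c \<and> x (n + i0) = d" for l
    proof -
      obtain m n where "m mod int (p (L + l)) = \<omega>' (L + l)" "n mod int (p (L + l)) = \<omega>' (L + l)"
          "x (m + i0) = c" "x (n + i0) = d"
        using cd[of l] by auto
      moreover from this have "m mod int (p l) = \<omega>' l" "n mod int (p l) = \<omega>' l"
        using down[of l "L + l"] by simp_all
      ultimately show ?thesis
        unfolding \<omega>_def translate_def by (metis mod_add_left_eq)
    qed
    then show "(\<omega>, c) \<in> F_set p x" "(\<omega>, d) \<in> F_set p x"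
      unfolding F_iff using \<omega> by blast+
  qed
  \<comment> \<open>Let \<open>x n = u\<close> with \<open>n\<close> near \<open>\<theta>\<close>.
    The windows around \<open>n - i0\<close> and \<open>m\<close> agree: at \<open>i0\<close> both
    show \<open>u\<close>, and any other difference would be a second hole. Hence
    \<open>y (n - i0) = e\<close>, while \<open>n - i0\<close> approaches the translate of
    \<open>\<theta>\<close>.\<close>
  have transfer: "(translate p (- i0) \<theta>, e) \<in> F_set p y"
    if \<theta>: "\<theta> L = \<omega> L" "(\<theta>, u) \<in> F_set p x"
      and m: "m mod int (p L) = \<omega>' L" "x (m + i0) = u" "y m = e" for \<theta> u e m
    unfolding F_iff
  proof (intro conjI allI)
    have \<theta>_in: "\<theta> \<in> odometer p"
      using \<theta>(2) unfolding F_iff by blast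
    then show "translate p (- i0) \<theta> \<in> odometer p"
      by (rule translate_in_odometer[OF pos dvd])
    fix l
    obtain n where n: "n mod int (p (L + l)) = \<theta> (L + l)" "x n = u"
      using \<theta>(2) unfolding F_iff by blast
    have nk: "n mod int (p k) = \<theta> k" if "k \<le> L + l" for k
      using that n(1) odometer_mod[OF \<theta>_in dvd that] mod_period_mono[OF dvd that] by metis
    have "n mod int (p L) = (m + i0) mod int (p L)"
      using nk[of L] \<theta>(1) m(1) unfolding \<omega>_def translate_def by (simp add: mod_simps) (metis mod_add_left_eq)
    then have "(n - i0) mod int (p L) = m mod int (p L)"
      by (metis add_diff_cancel_right' mod_diff_left_eq)
    then have "y (n - i0) = y m"
      using J hole[of "n - i0" m] unique m(1,2) n(2) by (metis diff_add_cancel)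
    moreover have "(n - i0) mod int (p l) = translate p (- i0) \<theta> l"
      using nk[of l] by (simp add: translate_def) (metis mod_diff_left_eq)
    ultimately show "\<exists>j. j mod int (p l) = translate p (- i0) \<theta> l \<and> y j = e"
      using m(3) by blast
  qed
  define S where "S = {\<theta> \<in> odometer p. \<theta> L = \<omega> L \<and> (\<theta>, c) \<in> F_set p x \<and> (\<theta>, d) \<in> F_set p x}"
  have "finite S"
  proof (rule inj_on_finite)
    show "finite (B_set p y)"
      using \<Psi>(3) by (simp add: y_def)
    show "inj_on (translate p (- i0)) S"
      by (rule inj_on_inverseI[where g = "translate p i0"])
        (use translate_translate[of _ p "- i0"] in \<open>simp add: S_def\<close>)
    show "translate p (- i0) ` S \<subseteq> B_set p y"
    proof
      fix \<theta>' assume "\<theta>' \<in> translate p (- i0) ` S"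
      then obtain \<theta> where \<theta>: "\<theta> \<in> S" "\<theta>' = translate p (- i0) \<theta>" by blast
      have "(\<theta>', a) \<in> F_set p y" "(\<theta>', b) \<in> F_set p y"
        \<comment> \<open>The samples at level \<open>L\<close> serve as \<open>m\<close>: one shows
          \<open>c\<close> and yields \<open>a\<close>, the other shows \<open>d\<close> and yields
          \<open>b\<close>.\<close>
        using cd[of 0] \<theta> transfer unfolding S_def by auto
      then show "\<theta>' \<in> B_set p y"
        unfolding B_iff using ab(1) by blast
    qed
  qed
  \<comment> \<open>\<open>k \<theta>\<close> is a coordinate separating \<open>\<theta>\<close>
    from \<open>\<omega>\<close>. A cylinder of depth \<open>max L M\<close> is deep enough to force
    the competing points into \<open>S\<close> and to exclude all of \<open>S\<close> but
    \<open>\<omega>\<close>.\<close>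
  have "\<exists>k. \<theta> k \<noteq> \<omega> k" if "\<theta> \<noteq> \<omega>" for \<theta> :: "nat \<Rightarrow> int"
    using that by auto
  then obtain k where k: "\<And>\<theta>. \<theta> \<noteq> \<omega> \<Longrightarrow> \<theta> (k \<theta>) \<noteq> \<omega> (k \<theta>)"
    by metis
  obtain M where M: "\<And>\<theta>. \<theta> \<in> S \<Longrightarrow> k \<theta> \<le> M"
    using finite_imageI[OF \<open>finite S\<close>, of k] unfolding finite_nat_set_iff_bounded_le by blast
  have "{\<theta> \<in> cylinder p \<omega> (max L M). (\<theta>, c) \<in> F_set p x \<and> (\<theta>, d) \<in> F_set p x} = {\<omega>}"
  proof (intro subset_antisym subsetI)
    fix \<theta> assume \<theta>: "\<theta> \<in> {\<theta> \<in> cylinder p \<omega> (max L M). (\<theta>, c) \<in> F_set p x \<and> (\<theta>, d) \<in> F_set p x}"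
    then have "\<theta> \<in> S"
      by (auto simp: S_def cylinder_def)
    then show "\<theta> \<in> {\<omega>}"
      using k[of \<theta>] M[of \<theta>] \<theta> by (auto simp: cylinder_def)
  qed (use \<omega> F\<omega> in \<open>auto simp: cylinder_def\<close>)
  then have "isolated_value_pair p x \<omega> c d"
    unfolding isolated_value_pair_def using cd_neq by blast
  moreover have "\<omega> \<in> B_set p x"
    unfolding B_iff using F\<omega> cd_neq by blast
  ultimately show ?thesis by blast
qed

end
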